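(* Let $\mathbf{R}$ be a commutative unital ring, let $\mathfrak{A}$ be a unital $\mathbf{R}$-algebra and let $\mathfrak{X}$ be an $\mathfrak{A}$-bimodule. Suppose that $\mathfrak{A}$ has a nontrivial idempotent $p$ such that, with $q=1-p$, one has $pxq=x$ for all $x\in\mathfrak{X}$. Suppose also that both $\mathfrak{A}$ and $\mathfrak{X}$ are $2$-torsion free. Let $\mathcal{L}$ be a Lie derivation on the trivial extension algebra $\mathfrak{A}\ltimes\mathfrak{X}$, written in the form $$\mathcal{L}(a,x)=(\mathcal{L}_{\mathfrak{A}}(a)+T(x),\ \mathcal{L}_{\mathfrak{X}}(a)+S(x))\qquad (a\in\mathfrak{A},\ x\in\mathfrak{X}),$$ where $\mathcal{L}_{\mathfrak{A}}:\mathfrak{A}\to\mathfrak{A}$, $\mathcal{L}_{\mathfrak{X}}:\mathfrak{A}\to\mathfrak{X}$, $T:\mathfrak{X}\to\mathfrak{A}$ and $S:\mathfrak{X}\to\mathfrak{X}$ are the (uniquely determined) linear component maps of $\mathcal{L}$. Then $\mathcal{L}$ is proper if and only if there exists a linear map $\ell_{\mathfrak{A}}:\mathfrak{A}\to Z(\mathfrak{A})$ satisfying the following conditions: (i) $\mathcal{L}_{\mathfrak{A}}-\ell_{\mathfrak{A}}$ is a derivation on $\mathfrak{A}$; (ii) $[\ell_{\mathfrak{A}}(pap),x]=0=[\ell_{\mathfrak{A}}(qaq),x]$ for all $a\in\mathfrak{A}$, $x\in\mathfrak{X}$.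
   Context: All algebras are over a commutative unital ring $\mathbf{R}$, and linear means $\mathbf{R}$-linear. $Z(\cdot)$ denotes the center of an algebra. An idempotent $p$ is nontrivial if $p\neq 0,1$. A module $\mathfrak{X}$ (or algebra) is $2$-torsion free if $2x=0$ implies $x=0$. Trivial extension algebra: for an $\mathfrak{A}$-bimodule $\mathfrak{X}$, $\mathfrak{A}\ltimes\mathfrak{X}$ is $\mathfrak{A}\times\mathfrak{X}$ with componentwise addition and scalar multiplication and with product $(a,x)(b,y)=(ab,\,ay+xb)$. Brackets: $[a,b]=ab-ba$ in an algebra; for $a\in\mathfrak{A}$ and $x\in\mathfrak{X}$, $[a,x]=ax-xa$ and $[x,a]=xa-ax$. A derivation on an algebra $\mathcal{B}$ is a linear map $\mathcal{D}:\mathcal{B}\to\mathcal{B}$ with $\mathcal{D}(ab)=\mathcal{D}(a)b+a\mathcal{D}(b)$ for all $a,b$. A Lie derivation on $\mathcal{B}$ is a linear map $\mathcal{L}:\mathcal{B}\to\mathcal{B}$ with $\mathcal{L}([a,b])=[\mathcal{L}(a),b]+[a,\mathcal{L}(b)]$ for all $a,b$. A Lie derivation on $\mathcal{B}$ is proper if it equals $\mathcal{D}+\ell$, where $\mathcal{D}:\mathcal{B}\to\mathcal{B}$ is a derivation and $\ell:\mathcal{B}\to Z(\mathcal{B})$ is a linear map with $\ell([a,b])=0$ for all $a,b\in\mathcal{B}$. *)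

theory Defs
  imports "HOL-Analysis.Product_Vector"
begin

text \<open>
  Algebras over a commutative ring are given by an explicit scalar multiplication and an explicit
  product on a type of class \<^class>\<open>ab_group_add\<close>. In this way the notions below apply both to an
  algebra whose product is the type class operation and to the trivial extension algebra, whose
  product on pairs depends on the bimodule actions.
\<close>

locale algebra_over = module smult
  for smult :: "'r::comm_ring_1 \<Rightarrow> 'b::ab_group_add \<Rightarrow> 'b" +
  fixes mult :: "'b \<Rightarrow> 'b \<Rightarrow> 'b"
  assumes mult_assoc: "mult (mult a b) c = mult a (mult b c)"
    and mult_add_left: "mult (a + b) c = mult a c + mult b c"
    and mult_add_right: "mult a (b + c) = mult a b + mult a c"
    and mult_scale_left: "mult (smult r a) b = smult r (mult a b)"
    and mult_scale_right: "mult a (smult r b) = smult r (mult a b)"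

definition commutator :: "('b::ab_group_add \<Rightarrow> 'b \<Rightarrow> 'b) \<Rightarrow> 'b \<Rightarrow> 'b \<Rightarrow> 'b" where
  "commutator mult a b = mult a b - mult b a"

definition center :: "('b \<Rightarrow> 'b \<Rightarrow> 'b) \<Rightarrow> 'b set" where
  "center mult = {z. \<forall>b. mult z b = mult b z}"

definition derivation ::
  "('r::comm_ring_1 \<Rightarrow> 'b::ab_group_add \<Rightarrow> 'b) \<Rightarrow> ('b \<Rightarrow> 'b \<Rightarrow> 'b) \<Rightarrow> ('b \<Rightarrow> 'b) \<Rightarrow> bool" where
  "derivation smult mult D \<longleftrightarrow>
     module_hom smult smult D \<and> (\<forall>a b. D (mult a b) = mult (D a) b + mult a (D b))"

definition lie_derivation ::
  "('r::comm_ring_1 \<Rightarrow> 'b::ab_group_add \<Rightarrow> 'b) \<Rightarrow> ('b \<Rightarrow> 'b \<Rightarrow> 'b) \<Rightarrow> ('b \<Rightarrow> 'b) \<Rightarrow> bool" where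
  "lie_derivation smult mult L \<longleftrightarrow>
     module_hom smult smult L \<and>
     (\<forall>a b. L (commutator mult a b) = commutator mult (L a) b + commutator mult a (L b))"

definition proper_lie_derivation ::
  "('r::comm_ring_1 \<Rightarrow> 'b::ab_group_add \<Rightarrow> 'b) \<Rightarrow> ('b \<Rightarrow> 'b \<Rightarrow> 'b) \<Rightarrow> ('b \<Rightarrow> 'b) \<Rightarrow> bool" where
  "proper_lie_derivation smult mult L \<longleftrightarrow>
     lie_derivation smult mult L \<and>
     (\<exists>D l. derivation smult mult D \<and>
        module_hom smult smult l \<and> range l \<subseteq> center mult \<and>
        (\<forall>a b. l (commutator mult a b) = 0) \<and>
        (\<forall>b. L b = D b + l b))"

text \<open>
  The actions are not assumed to be unital; scalars act in the same way through either side.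
\<close>

locale algebra_bimodule =
  A: algebra_over scaleA "(*)" + X: module scaleX
  for scaleA :: "'r::comm_ring_1 \<Rightarrow> 'a::ring_1 \<Rightarrow> 'a"
    and scaleX :: "'r \<Rightarrow> 'x::ab_group_add \<Rightarrow> 'x" +
  fixes lact :: "'a \<Rightarrow> 'x \<Rightarrow> 'x"
    and ract :: "'x \<Rightarrow> 'a \<Rightarrow> 'x"
  assumes lact_add_left: "lact (a + b) x = lact a x + lact b x"
    and lact_add_right: "lact a (x + y) = lact a x + lact a y"
    and lact_scale_left: "lact (scaleA r a) x = scaleX r (lact a x)"
    and lact_scale_right: "lact a (scaleX r x) = scaleX r (lact a x)"
    and lact_mult: "lact (a * b) x = lact a (lact b x)"
    and ract_add_left: "ract (x + y) a = ract x a + ract y a"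
    and ract_add_right: "ract x (a + b) = ract x a + ract x b"
    and ract_scale_left: "ract (scaleX r x) a = scaleX r (ract x a)"
    and ract_scale_right: "ract x (scaleA r a) = scaleX r (ract x a)"
    and ract_mult: "ract x (a * b) = ract (ract x a) b"
    and lact_ract: "ract (lact a x) b = lact a (ract x b)"

definition bimodule_commutator ::
  "('a \<Rightarrow> 'x::ab_group_add \<Rightarrow> 'x) \<Rightarrow> ('x \<Rightarrow> 'a \<Rightarrow> 'x) \<Rightarrow> 'a \<Rightarrow> 'x \<Rightarrow> 'x" where
  "bimodule_commutator lact ract a x = lact a x - ract x a"

definition triv_ext_mult ::
  "('a::ring_1 \<Rightarrow> 'x::ab_group_add \<Rightarrow> 'x) \<Rightarrow> ('x \<Rightarrow> 'a \<Rightarrow> 'x) \<Rightarrow> 'a \<times> 'x \<Rightarrow> 'a \<times> 'x \<Rightarrow> 'a \<times> 'x" where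
  "triv_ext_mult lact ract u v =
     (fst u * fst v, lact (fst u) (snd v) + ract (snd u) (fst v))"

abbreviation triv_ext_scale ::
  "('r::comm_ring_1 \<Rightarrow> 'a::ring_1 \<Rightarrow> 'a) \<Rightarrow> ('r \<Rightarrow> 'x::ab_group_add \<Rightarrow> 'x) \<Rightarrow> 'r \<Rightarrow> 'a \<times> 'x \<Rightarrow> 'a \<times> 'x" where
  "triv_ext_scale \<equiv> module_prod.scale"

context algebra_bimodule
begin

sublocale AX: module_prod scaleA scaleX ..

lemma triv_ext_algebra:
  "algebra_over (triv_ext_scale scaleA scaleX) (triv_ext_mult lact ract)"
  by unfold_locales
    (auto simp: triv_ext_mult_def AX.scale_def algebra_simps A.mult_scale_left A.mult_scale_right
      lact_add_left lact_add_right lact_scale_left lact_scale_right lact_mult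
      ract_add_left ract_add_right ract_scale_left ract_scale_right ract_mult lact_ract
      X.scale_right_distrib)

end

end

theory Submission
  imports Defs
begin

text \<open>
  Since \<open>x = pxq\<close>, the module only sees the diagonal corners: \<open>ax = (pap)x\<close> and \<open>xa = x(qaq)\<close>.
  Hence the center of the trivial extension consists of the pairs \<open>(c, 0)\<close> with \<open>c\<close> central in the
  algebra and commuting with the module, which gives the forward direction. Conversely, \<open>\<ell>\<close> vanishes
  on commutators because it is a Lie derivation with central values; so it kills \<open>paq = [p, paq]\<close> and
  \<open>qap = [qap, p]\<close>, and by (ii) all its values commute with the module. Thus \<open>(a, x) \<mapsto> (\<ell>(a), 0)\<close> is
  central, and the difference with the given map is a derivation: bracketing with \<open>p\<close>, \<open>pap\<close> and
  \<open>qaq\<close> turns the Lie identities for the four components into the Leibniz identities.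
\<close>

section \<open>Peirce corners of the idempotent and their action on the module\<close>

locale peirce_bimodule = algebra_bimodule scaleA scaleX lact ract
  for scaleA :: "'r::comm_ring_1 \<Rightarrow> 'a::ring_1 \<Rightarrow> 'a"
    and scaleX :: "'r \<Rightarrow> 'x::ab_group_add \<Rightarrow> 'x"
    and lact :: "'a \<Rightarrow> 'x \<Rightarrow> 'x"
    and ract :: "'x \<Rightarrow> 'a \<Rightarrow> 'x" +
  fixes p q :: 'a
  assumes idem: "p * p = p"
    and q_eq: "q = 1 - p"
    and pxq: "ract (lact p x) q = x"
begin

lemma corner_simps:
  "p * p = p" "q * q = q" "p * q = 0" "q * p = 0"
  "p * (p * a) = p * a" "q * (q * a) = q * a" "p * (q * a) = 0" "q * (p * a) = 0"
proof -
  show base: "p * p = p" "q * q = q" "p * q = 0" "q * p = 0"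
    using idem by (simp_all add: q_eq algebra_simps)
  show "p * (p * a) = p * a" "q * (q * a) = q * a" "p * (q * a) = 0" "q * (p * a) = 0"
    by (simp_all add: mult.assoc [symmetric] base)
qed

lemma peirce_decomposition: "a = p * a * p + p * a * q + q * a * p + q * a * q"
  by (simp add: q_eq algebra_simps)

lemma additive_eq_0I:
  assumes "\<And>a b. f (a + b) = f a + (f b :: 'b::group_add)"
    and "\<And>a. f (p * a * p) = 0" "\<And>a. f (p * a * q) = 0"
    and "\<And>a. f (q * a * p) = 0" "\<And>a. f (q * a * q) = 0"
  shows "f a = 0"
  by (subst peirce_decomposition [of a]) (simp only: assms add_0)

sublocale lact_left: additive "\<lambda>a. lact a x" for x
  by unfold_locales (rule lact_add_left)
sublocale lact_right: additive "\<lambda>x. lact a x" for a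
  by unfold_locales (rule lact_add_right)
sublocale ract_left: additive "\<lambda>x. ract x a" for a
  by unfold_locales (rule ract_add_left)
sublocale ract_right: additive "\<lambda>a. ract x a" for x
  by unfold_locales (rule ract_add_right)

text \<open>Acting once more by \<open>p\<close> or \<open>q\<close> on \<open>x = pxq\<close> is
  absorbed by idempotence, and \<open>qp = 0\<close> kills the other side. As
  \<open>p + q = 1\<close>, both actions turn out unital.\<close>

lemma action_corner [simp]:
  "lact p x = x" "ract x q = x" "lact q x = 0" "ract x p = 0"
proof -
  show lp: "lact p x = x"
    by (metis pxq lact_ract lact_mult idem)
  show rq: "ract x q = x"
    by (metis pxq ract_mult corner_simps(2))
  show "lact q x = 0"
    by (metis lp lact_mult corner_simps(4) lact_left.zero)
  show "ract x p = 0"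
    by (metis rq ract_mult corner_simps(4) ract_right.zero)
qed

lemmas bimodule_simps =
  lact_add_left lact_add_right lact_mult ract_add_left ract_add_right ract_mult lact_ract
  lact_left.zero lact_right.zero ract_left.zero ract_right.zero
  lact_left.diff lact_right.diff ract_left.diff ract_right.diff
  lact_left.minus lact_right.minus ract_left.minus ract_right.minus

text \<open>The test elements are \<open>(b, 0)\<close>, \<open>(0, x)\<close> and
  \<open>(p, 0)\<close>. The last one forces \<open>snd z = 0\<close> because \<open>p\<close> is
  the identity on the left of the module and zero on its right.\<close>

lemma center_triv_ext:
  assumes "z \<in> center (triv_ext_mult lact ract)"
  shows "fst z \<in> center (*)" and "bimodule_commutator lact ract (fst z) x = 0" and "snd z = 0"
proof -
  have comm: "triv_ext_mult lact ract z w = triv_ext_mult lact ract w z" for w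
    using assms unfolding center_def by blast
  show "fst z \<in> center (*)"
    using comm [of "(b, 0)" for b] by (simp add: center_def triv_ext_mult_def)
  show "bimodule_commutator lact ract (fst z) x = 0"
    using comm [of "(0, x)"]
    by (simp add: bimodule_commutator_def triv_ext_mult_def bimodule_simps)
  show "snd z = 0"
    using comm [of "(p, 0)"] by (simp add: triv_ext_mult_def bimodule_simps)
qed

lemma center_triv_extI:
  assumes "c \<in> center (*)" and "\<And>x. bimodule_commutator lact ract c x = 0"
  shows "(c, 0) \<in> center (triv_ext_mult lact ract)"
  using assms by (auto simp: center_def bimodule_commutator_def triv_ext_mult_def bimodule_simps)

section \<open>From Lie identities to Leibniz identities for the component maps\<close>

text \<open>Brackets with \<open>p\<close> determine \<open>f\<close> on every corner but
  \<open>paq\<close>; there, brackets with the diagonal corners make \<open>f\<close> compatible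
  with both actions. The minus sign in \<open>lie\<close> stands for
  \<open>[f a, b] = -[b, f a]\<close>.\<close>

lemma bimodule_lie_derivation_is_derivation:
  assumes two: "\<And>x::'x. x + x = 0 \<Longrightarrow> x = 0"
    and add: "\<And>a b. f (a + b) = f a + f b"
    and lie: "\<And>a b. f (a * b - b * a) =
      bimodule_commutator lact ract a (f b) - bimodule_commutator lact ract b (f a)"
  shows "f (a * b) = lact a (f b) + ract (f a) b"
proof -
  interpret f: additive f by unfold_locales (rule add)
  have pp: "f (p * a * p) = lact a (f p)" for a
  proof -
    have "p * a * p * p - p * (p * a * p) = 0"
      by (simp add: corner_simps mult.assoc)
    from lie [of "p * a * p" p, unfolded this] show ?thesis
      by (simp add: bimodule_commutator_def bimodule_simps f.zero)
  qed
  have qq: "f (q * a * q) = - ract (f p) a" for a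
  proof -
    have "q * a * q * p - p * (q * a * q) = 0"
      by (simp add: corner_simps mult.assoc)
    from lie [of "q * a * q" p, unfolded this] show ?thesis
      by (simp add: bimodule_commutator_def bimodule_simps f.zero)
  qed
  have qp: "f (q * a * p) = 0" for a
  proof -
    have "q * a * p * p - p * (q * a * p) = q * a * p"
      by (simp add: corner_simps mult.assoc)
    note lie [of "q * a * p" p, unfolded this]
    also have "bimodule_commutator lact ract (q * a * p) (f p) -
        bimodule_commutator lact ract p (f (q * a * p)) = - f (q * a * p)"
      by (simp add: bimodule_commutator_def bimodule_simps)
    finally have "f (q * a * p) + f (q * a * p) = 0"
      by (metis add.right_inverse)
    thus ?thesis by (rule two)
  qed
  \<comment> \<open>so \<open>f\<close> is the inner derivation given by \<open>f p\<close> plus a map seeing only the corner \<open>paq\<close>\<close>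
  have f_eq: "f a = lact a (f p) - ract (f p) a + f (p * a * q)" for a
    by (subst (1) peirce_decomposition [of a]) (simp only: add pp qq qp, simp)
  have left: "f (p * a * p * b * q) = lact a (f (p * b * q))" for a b
  proof -
    have "p * a * p * (p * b * q) - p * b * q * (p * a * p) = p * a * p * b * q"
      by (simp add: corner_simps mult.assoc)
    from lie [of "p * a * p" "p * b * q", unfolded this] show ?thesis
      by (simp add: bimodule_commutator_def bimodule_simps)
  qed
  have right: "f (p * a * q * b * q) = ract (f (p * a * q)) b" for a b
  proof -
    have "p * a * q * (q * b * q) - q * b * q * (p * a * q) = p * a * q * b * q"
      by (simp add: corner_simps mult.assoc)
    from lie [of "p * a * q" "q * b * q", unfolded this] show ?thesis
      by (simp add: bimodule_commutator_def bimodule_simps)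
  qed
  \<comment> \<open>Insert \<open>1 = p + q\<close> between \<open>a\<close> and
    \<open>b\<close>.\<close>
  have "p * (a * b) * q = p * a * p * b * q + p * a * q * b * q"
    by (simp add: q_eq algebra_simps)
  hence "f (p * (a * b) * q) = lact a (f (p * b * q)) + ract (f (p * a * q)) b"
    by (simp only: add left right)
  thus ?thesis
    by (simp add: f_eq [of "a * b"] f_eq [of a] f_eq [of b] bimodule_simps)
qed

text \<open>As \<open>[p, x] = x\<close>, also \<open>[p, T x] = T x\<close>. Bracketing with
  \<open>p\<close> is zero on the diagonal corners and negation on the corner \<open>q(-)p\<close>,
  so without 2-torsion its fixed points lie in \<open>p(-)q\<close>.\<close>

lemma lie_hom_corner:
  assumes two: "\<And>a::'a. a + a = 0 \<Longrightarrow> a = 0"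
    and lie: "\<And>a x. T (bimodule_commutator lact ract a x) = a * T x - T x * a"
  shows "p * T x = T x" and "T x * q = T x"
proof -
  have T_eq: "T x = p * T x - T x * p"
    using lie [of p x] by (simp add: bimodule_commutator_def)
  have "q * T x = q * (p * T x - T x * p)"
    by (rule arg_cong [OF T_eq])
  also have "\<dots> = - (q * T x * p)"
    by (simp add: right_diff_distrib corner_simps mult.assoc)
  finally have qT: "q * T x = - (q * T x * p)" .
  have "q * T x * p = - (q * T x * p) * p"
    by (simp only: qT [symmetric])
  also have "\<dots> = - (q * T x * p)"
    by (simp add: mult.assoc corner_simps)
  finally have "q * T x * p = - (q * T x * p)" .
  hence "q * T x * p + q * T x * p = 0"
    by (metis add.right_inverse)
  hence qTp: "q * T x * p = 0"
    by (rule two)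
  with qT have "q * T x = 0" by simp
  thus pT: "p * T x = T x"
    by (simp add: q_eq algebra_simps)
  from T_eq pT have "T x * p = 0" by simp
  thus "T x * q = T x"
    by (simp add: q_eq algebra_simps)
qed

text \<open>On the module \<open>pap\<close> is \<open>a\<close> from the left and zero from the
  right, and \<open>qaq\<close> the reverse. Their brackets give the claims up to the terms
  \<open>q * a * T x\<close> and \<open>T x * a * p\<close>, which have to vanish.\<close>

lemma lie_hom_is_bimodule_hom:
  assumes two: "\<And>a::'a. a + a = 0 \<Longrightarrow> a = 0"
    and add: "\<And>x y. T (x + y) = T x + T y"
    and lie: "\<And>a x. T (bimodule_commutator lact ract a x) = a * T x - T x * a"
  shows "T (lact a x) = a * T x" and "T (ract x a) = T x * a"
proof -
  interpret T: additive T by unfold_locales (rule add)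
  note corner = lie_hom_corner [OF two lie, of x]
  have qT: "q * T x = 0"
    using corner_simps(8) [of "T x"] by (simp only: corner(1))
  have Tp: "T x * p = 0"
    by (metis corner(2) mult.assoc corner_simps(4) mult_zero_right)
  \<comment> \<open>\<open>q * a * p\<close> acts as zero on both sides of the module, so
    \<open>T x\<close> commutes with it.\<close>
  have off: "q * a * T x = T x * a * p"
    using lie [of "q * a * p" x] corner
    by (simp add: bimodule_commutator_def bimodule_simps T.zero mult.assoc)
      (simp add: mult.assoc [symmetric])
  have qaT: "q * a * T x = 0"
  proof -
    have "q * a * T x = q * (q * a * T x)"
      by (simp add: corner_simps mult.assoc)
    also have "\<dots> = q * T x * a * p"
      by (simp only: off) (simp only: mult.assoc)
    finally show ?thesis by (simp add: qT)
  qed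
  with off have Tap: "T x * a * p = 0" by simp
  have "T (lact a x) = p * a * T x"
    using lie [of "p * a * p" x] corner(1) Tp
    by (simp add: bimodule_commutator_def bimodule_simps mult.assoc)
      (simp add: mult.assoc [symmetric])
  with qaT show "T (lact a x) = a * T x"
    by (simp add: q_eq algebra_simps)
  have "T (ract x a) = T x * a * q"
    using lie [of "q * a * q" x] corner(2) qT
    by (simp add: bimodule_commutator_def bimodule_simps mult.assoc T.minus)
      (simp add: mult.assoc [symmetric])
  with Tap show "T (ract x a) = T x * a"
    by (simp add: q_eq algebra_simps)
qed

text \<open>A derivation satisfies \<open>e * D e * e = 0\<close> at an idempotent \<open>e\<close>,
  so \<open>D p\<close> acts as zero from the left and \<open>D q\<close> from the right. Hence
  \<open>D (p * a * p)\<close> acts from the left like \<open>D a\<close> and from the right like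
  zero, and symmetrically for \<open>q\<close>; this separates the two Leibniz rules.\<close>

lemma lie_twisted_hom_is_derivation:
  assumes leibniz: "\<And>a b. D (a * b) = D a * b + a * D b"
    and add: "\<And>x y. S (x + y) = S x + S y"
    and lie: "\<And>a x. S (bimodule_commutator lact ract a x) =
      bimodule_commutator lact ract (D a) x + bimodule_commutator lact ract a (S x)"
  shows "S (lact a x) = lact (D a) x + lact a (S x)"
    and "S (ract x a) = ract (S x) a + ract x (D a)"
proof -
  interpret S: additive S by unfold_locales (rule add)
  have idem_D: "e * D e * e = 0" if "e * e = e" for e
  proof -
    have "e * D (e * e) * e = e * D e * e + e * D e * e"
      by (simp only: leibniz ring_distribs) (metis mult.assoc that)
    thus ?thesis unfolding that by simp
  qed
  have Dp: "lact (D p) y = 0" for y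
  proof -
    have "lact (D p) y = lact (p * D p * p) y" by (simp add: bimodule_simps)
    thus ?thesis by (simp only: idem_D [OF idem] lact_left.zero)
  qed
  have Dq: "ract y (D q) = 0" for y
  proof -
    have "ract y (D q) = ract y (q * D q * q)" by (simp add: bimodule_simps)
    thus ?thesis by (simp only: idem_D [OF corner_simps(2)] ract_right.zero)
  qed
  show "S (lact a x) = lact (D a) x + lact a (S x)"
    using lie [of "p * a * p" x]
    by (simp add: bimodule_commutator_def leibniz bimodule_simps Dp)
  have "S (ract x a) = - S (bimodule_commutator lact ract (q * a * q) x)"
    by (simp add: bimodule_commutator_def bimodule_simps S.minus)
  thus "S (ract x a) = ract (S x) a + ract x (D a)"
    unfolding lie
    by (simp add: bimodule_commutator_def leibniz bimodule_simps Dq)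
qed

end

theorem theorem2p2:
  fixes scaleA :: "'r::comm_ring_1 \<Rightarrow> 'a::ring_1 \<Rightarrow> 'a"
    and scaleX :: "'r \<Rightarrow> 'x::ab_group_add \<Rightarrow> 'x"
    and lact :: "'a \<Rightarrow> 'x \<Rightarrow> 'x"
    and ract :: "'x \<Rightarrow> 'a \<Rightarrow> 'x"
    and p q :: 'a
    and L :: "'a \<times> 'x \<Rightarrow> 'a \<times> 'x"
    and LA :: "'a \<Rightarrow> 'a" and LX :: "'a \<Rightarrow> 'x"
    and T :: "'x \<Rightarrow> 'a" and S :: "'x \<Rightarrow> 'x"
  assumes bimodule: "algebra_bimodule scaleA scaleX lact ract"
    and idempotent: "p * p = p"
    and nontrivial: "p \<noteq> 0" "p \<noteq> 1"
    and q: "q = 1 - p"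
    and pxq: "\<And>x. ract (lact p x) q = x"
    and torsion_free_A: "\<And>a::'a. a + a = 0 \<Longrightarrow> a = 0"
    and torsion_free_X: "\<And>x::'x. x + x = 0 \<Longrightarrow> x = 0"
    and lie: "lie_derivation (triv_ext_scale scaleA scaleX) (triv_ext_mult lact ract) L"
    and linear_LA: "module_hom scaleA scaleA LA"
    and linear_LX: "module_hom scaleA scaleX LX"
    and linear_T: "module_hom scaleX scaleA T"
    and linear_S: "module_hom scaleX scaleX S"
    and L: "\<And>a x. L (a, x) = (LA a + T x, LX a + S x)"
  shows "proper_lie_derivation (triv_ext_scale scaleA scaleX) (triv_ext_mult lact ract) L \<longleftrightarrow>
    (\<exists>lA. module_hom scaleA scaleA lA \<and> range lA \<subseteq> center (*) \<and>
       derivation scaleA (*) (\<lambda>a. LA a - lA a) \<and>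
       (\<forall>a x. bimodule_commutator lact ract (lA (p * a * p)) x = 0 \<and>
              bimodule_commutator lact ract (lA (q * a * q)) x = 0))"
proof -
  interpret peirce_bimodule scaleA scaleX lact ract p q
    by (intro peirce_bimodule.intro peirce_bimodule_axioms.intro bimodule idempotent q pxq)
  let ?mult = "triv_ext_mult lact ract" and ?scale = "triv_ext_scale scaleA scaleX"
  have mod: "module ?scale" "module scaleA" "module scaleX"
    by (rule AX.p.module_axioms A.module_axioms X.module_axioms)+
  have LA_add: "LA (a + b) = LA a + LA b" for a b
    using linear_LA by (simp add: module_hom_iff)
  have LX_add: "LX (a + b) = LX a + LX b" for a b
    using linear_LX by (simp add: module_hom_iff)
  have T_add: "T (x + y) = T x + T y" for x y
    using linear_T by (simp add: module_hom_iff)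
  have S_add: "S (x + y) = S x + S y" for x y
    using linear_S by (simp add: module_hom_iff)
  have zeros: "LA 0 = 0" "LX 0 = 0" "T 0 = 0" "S 0 = 0"
    using LA_add [of 0 0] LX_add [of 0 0] T_add [of 0 0] S_add [of 0 0] by simp_all
  have lie_eq: "L (?mult u v - ?mult v u) =
      ?mult (L u) v - ?mult v (L u) + (?mult u (L v) - ?mult (L v) u)" for u v
    using lie unfolding lie_derivation_def commutator_def by blast
  have LA_lie: "LA (a * b - b * a) = LA a * b - b * LA a + (a * LA b - LA b * a)"
    and LX_lie: "LX (a * b - b * a) =
      bimodule_commutator lact ract a (LX b) - bimodule_commutator lact ract b (LX a)" for a b
    using lie_eq [of "(a, 0)" "(b, 0)"]
    by (simp_all add: triv_ext_mult_def L zeros bimodule_simps bimodule_commutator_def)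
  have T_lie: "T (bimodule_commutator lact ract a x) = a * T x - T x * a"
    and S_lie: "S (bimodule_commutator lact ract a x) =
      bimodule_commutator lact ract (LA a) x + bimodule_commutator lact ract a (S x)" for a x
    using lie_eq [of "(a, 0)" "(0, x)"]
    by (simp_all add: triv_ext_mult_def L zeros bimodule_simps bimodule_commutator_def)
  show ?thesis
  proof
    assume "proper_lie_derivation ?scale ?mult L"
    then obtain D l where D: "derivation ?scale ?mult D"
      and l: "module_hom ?scale ?scale l" and l_center: "range l \<subseteq> center ?mult"
      and L_eq: "\<And>b. L b = D b + l b"
      unfolding proper_lie_derivation_def by blast
    \<comment> \<open>Values of \<open>l\<close> are central, so those of \<open>lA\<close> commute
      with the algebra and with the whole module; (ii) is a special case.\<close>
    define lA where "lA a = fst (l (a, 0))" for a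
    have l_add: "l (u + v) = l u + l v" and l_scale: "l (?scale r u) = ?scale r (l u)" for r u v
      using l unfolding module_hom_iff by blast+
    have lA_hom: "module_hom scaleA scaleA lA"
      using mod l_add [of "(a, 0)" "(b, 0)" for a b] l_scale [of _ "(a, 0)" for a]
      by (simp add: module_hom_iff lA_def AX.scale_def)
    moreover have "range lA \<subseteq> center (*)"
      and l_comm: "bimodule_commutator lact ract (lA a) x = 0" for a x
      using center_triv_ext l_center unfolding lA_def by blast+
    moreover have "derivation scaleA (*) (\<lambda>a. LA a - lA a)"
    proof -
      have fst_D: "fst (D (a, 0)) = LA a - lA a" for a
        using L_eq [of "(a, 0)"] by (simp add: L zeros lA_def prod_eq_iff)
      have "fst (D (a * b, 0)) = fst (D (a, 0)) * b + a * fst (D (b, 0))" for a b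
      proof -
        have "D (?mult (a, 0) (b, 0)) = ?mult (D (a, 0)) (b, 0) + ?mult (a, 0) (D (b, 0))"
          using D unfolding derivation_def by blast
        thus ?thesis by (simp add: triv_ext_mult_def bimodule_simps)
      qed
      moreover have "module_hom scaleA scaleA (\<lambda>a. LA a - lA a)"
        by (rule module_pair.module_hom_sub [OF module_pair.intro linear_LA lA_hom]) (rule mod)+
      ultimately show ?thesis
        by (simp add: derivation_def fst_D)
    qed
    ultimately show "\<exists>lA. module_hom scaleA scaleA lA \<and> range lA \<subseteq> center (*) \<and>
       derivation scaleA (*) (\<lambda>a. LA a - lA a) \<and>
       (\<forall>a x. bimodule_commutator lact ract (lA (p * a * p)) x = 0 \<and>
              bimodule_commutator lact ract (lA (q * a * q)) x = 0)"
      by blast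
  next
    assume "\<exists>lA. module_hom scaleA scaleA lA \<and> range lA \<subseteq> center (*) \<and>
       derivation scaleA (*) (\<lambda>a. LA a - lA a) \<and>
       (\<forall>a x. bimodule_commutator lact ract (lA (p * a * p)) x = 0 \<and>
              bimodule_commutator lact ract (lA (q * a * q)) x = 0)"
    then obtain lA where lA: "module_hom scaleA scaleA lA" and lA_center: "range lA \<subseteq> center (*)"
      and D: "derivation scaleA (*) (\<lambda>a. LA a - lA a)"
      and lA_pp: "\<And>a x. bimodule_commutator lact ract (lA (p * a * p)) x = 0"
      and lA_qq: "\<And>a x. bimodule_commutator lact ract (lA (q * a * q)) x = 0"
      by blast
    define DA where "DA a = LA a - lA a" for a
    have LA_eq: "LA a = DA a + lA a" for a
      by (simp add: DA_def)
    have DA_mult: "DA (a * b) = DA a * b + a * DA b" for a b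
      using D by (simp add: derivation_def DA_def)
    have lA_add: "lA (a + b) = lA a + lA b" and lA_scale: "lA (scaleA r a) = scaleA r (lA a)" for r a b
      using lA by (simp_all add: module_hom_iff)
    interpret lA: additive lA by unfold_locales (rule lA_add)
    have DA_add: "DA (a + b) = DA a + DA b" for a b
      by (simp add: DA_def LA_add lA_add)
    interpret DA: additive DA by unfold_locales (rule DA_add)
    have lA_comm: "lA a * b = b * lA a" for a b
      using lA_center by (auto simp: center_def)
    \<comment> \<open>In the Lie identity for \<open>LA = DA + lA\<close> the derivation part
      cancels and the central values drop out of the brackets.\<close>
    have lA_0: "lA (a * b - b * a) = 0" for a b
      using LA_lie [of a b] by (simp add: LA_eq DA.diff DA_mult lA_comm algebra_simps)
    have lA_pq: "lA (p * a * q) = 0" for a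
      using lA_0 [of p "p * a * q"] by (simp add: mult.assoc corner_simps)
    have lA_qp: "lA (q * a * p) = 0" for a
      using lA_0 [of "q * a * p" p] by (simp add: mult.assoc corner_simps)
    have lA_X: "bimodule_commutator lact ract (lA a) x = 0" for a x
    proof (rule additive_eq_0I [where f = "\<lambda>a. bimodule_commutator lact ract (lA a) x"])
      show "bimodule_commutator lact ract (lA (a + b)) x =
        bimodule_commutator lact ract (lA a) x + bimodule_commutator lact ract (lA b) x" for a b
        by (simp add: bimodule_commutator_def lA_add bimodule_simps)
    qed (simp_all only: lA_pp lA_qq lA_pq lA_qp, simp_all add: bimodule_commutator_def bimodule_simps)
    have LX_mult: "LX (a * b) = lact a (LX b) + ract (LX a) b" for a b
      by (rule bimodule_lie_derivation_is_derivation [OF torsion_free_X LX_add LX_lie])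
    note T_hom = lie_hom_is_bimodule_hom [OF torsion_free_A T_add T_lie]
    \<comment> \<open>Since \<open>lA\<close> commutes with the module, \<open>LA\<close> may be
      replaced by the genuine derivation \<open>DA\<close>.\<close>
    have S_lie_DA: "S (bimodule_commutator lact ract a x) =
      bimodule_commutator lact ract (DA a) x + bimodule_commutator lact ract a (S x)" for a x
      using S_lie [of a x] lA_X [of a x]
      by (simp add: LA_eq bimodule_commutator_def bimodule_simps)
    note S_der = lie_twisted_hom_is_derivation [OF DA_mult S_add S_lie_DA]
    \<comment> \<open>\<open>T x\<close> lies in the corner \<open>p(-)q\<close>, which annihilates the module\<close>
    have T_act: "lact (T x) y = 0" "ract y (T x) = 0" for x y
    proof -
      note corner = lie_hom_corner [OF torsion_free_A T_lie, of x]
      show "lact (T x) y = 0"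
        by (metis corner(2) lact_mult action_corner(3) lact_right.zero)
      show "ract y (T x) = 0"
        by (metis corner(1) ract_mult action_corner(4) ract_left.zero)
    qed
    \<comment> \<open>The zero is forced: central elements have no module component. Thus
      \<open>T\<close>, \<open>LX\<close> and \<open>S\<close> all go into
      \<open>D'\<close>.\<close>
    let ?l = "\<lambda>u. (lA (fst u), 0 :: 'x)"
    define D' where "D' u = L u - ?l u" for u
    have l_hom: "module_hom ?scale ?scale ?l"
      using mod by (simp add: module_hom_iff AX.scale_def lA_add lA_scale)
    have L_hom: "module_hom ?scale ?scale L"
      using lie by (simp add: lie_derivation_def)
    have "derivation ?scale ?mult D'"
      unfolding derivation_def
    proof (intro conjI allI)
      show "module_hom ?scale ?scale D'"
        unfolding D'_def
        by (rule module_pair.module_hom_sub [OF module_pair.intro L_hom l_hom]) (rule mod)+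
      show "D' (?mult u v) = ?mult (D' u) v + ?mult u (D' v)" for u v
      proof -
        obtain a x b y where uv: "u = (a, x)" "v = (b, y)"
          by fastforce
        have D_eq: "D' (c, z) = (DA c + T z, LX c + S z)" for c z
          by (simp add: D'_def L DA_def)
        \<comment> \<open>The algebra component combines \<open>DA_mult\<close> with
          \<open>T_hom\<close>. In the module component \<open>T_act\<close> removes the terms where
          values of \<open>T\<close> act, leaving the rules for \<open>LX\<close> and
          \<open>S\<close>.\<close>
        show ?thesis
          by (simp only: uv D_eq triv_ext_mult_def fst_conv snd_conv add_Pair prod.inject)
            (simp add: DA_mult LX_mult T_add S_add T_hom S_der T_act bimodule_simps algebra_simps)
      qed
    qed
    moreover have "range ?l \<subseteq> center ?mult"
      using lA_center lA_X center_triv_extI by blast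
    moreover have "?l (commutator ?mult u v) = 0" for u v
      by (simp add: commutator_def triv_ext_mult_def lA_0 zero_prod_def)
    ultimately show "proper_lie_derivation ?scale ?mult L"
      unfolding proper_lie_derivation_def using lie l_hom
      by (intro conjI exI [of _ D'] exI [of _ ?l]) (auto simp: D'_def)
  qed
qed

end
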